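(* Let $j \in \omega$ and let $c \colon [2^\omega]^2 \to j$ be Baire-measurable. Then there is a splitting tree $T$ such that $[T]$ is $c$-homogeneous, i.e. $c$ is constant on $[[T]]^2$. In other words, $2^{<\omega} \rightarrow_{\mathrm{baire}} (\mathbb{SP})^2_j$.
   Context: $[2^\omega]^2$ is the set of two-element subsets of $2^\omega$, identified with the set of pairs $(x,y) \in (2^\omega)^2$ with $x \neq y$ (colorings being symmetric); Baire-measurability refers to this topology. A tree is a set $T \subseteq 2^{<\omega}$ closed under initial segments; $[T]$ is its set of infinite branches and $[[T]]^2$ the set of two-element subsets of $[T]$. For $t \in T$, $T \restriction t = \{ s \in T : s \subseteq t \text{ or } t \subseteq s\}$. For $a \subseteq \omega$ and $X \subseteq 2^{\leq \omega}$, $X$ covers $a$ if for every $n \in a$ and $i \in 2$ there is $s \in X$ with $n \in \operatorname{dom}(s)$ and $s(n) = i$. A tree $T \subseteq 2^{<\omega}$ is a splitting tree if for every $t \in T$, $T \restriction t$ covers a cofinite subset of $\omega$; $\mathbb{SP}$ is the set of splitting trees. *)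

theory Defs
  imports "HOL-Analysis.Analysis" "HOL-Library.Ramsey" "HOL-Library.Sublist"
begin

definition nowhere_dense_in :: "'a topology \<Rightarrow> 'a set \<Rightarrow> bool" where
  "nowhere_dense_in X S \<longleftrightarrow> S \<subseteq> topspace X \<and> X interior_of (X closure_of S) = {}"

definition meager_in :: "'a topology \<Rightarrow> 'a set \<Rightarrow> bool" where
  "meager_in X S \<longleftrightarrow> (\<exists>N :: nat \<Rightarrow> 'a set. (\<forall>n. nowhere_dense_in X (N n)) \<and> S = (\<Union>n. N n))"

definition baire_property_in :: "'a topology \<Rightarrow> 'a set \<Rightarrow> bool" where
  "baire_property_in X S \<longleftrightarrow>
     S \<subseteq> topspace X \<and> (\<exists>U. openin X U \<and> meager_in X ((S - U) \<union> (U - S)))"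

definition baire_measurable_map :: "'a topology \<Rightarrow> 'b topology \<Rightarrow> ('a \<Rightarrow> 'b) \<Rightarrow> bool" where
  "baire_measurable_map X Y f \<longleftrightarrow>
     f \<in> topspace X \<rightarrow> topspace Y \<and>
     (\<forall>V. openin Y V \<longrightarrow> baire_property_in X {x \<in> topspace X. f x \<in> V})"

text \<open>
  The Cantor space is the type \<^typ>\<open>nat \<Rightarrow> bool\<close> with its product topology, \<^typ>\<open>bool\<close> being
  discrete. A coloring is a function on two-element sets; its Baire-measurability is that of the
  induced symmetric function on pairs of distinct points. The set of colors is the ordinal
  \<open>j = {0, ..., j - 1}\<close> with the discrete topology.
\<close>

type_synonym cantor = "nat \<Rightarrow> bool"

definition off_diagonal :: "(cantor \<times> cantor) topology" where
  "off_diagonal = top_of_set {(x, y). x \<noteq> y}"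

definition baire_coloring :: "nat \<Rightarrow> (cantor set \<Rightarrow> nat) \<Rightarrow> bool" where
  "baire_coloring j c \<longleftrightarrow>
     c \<in> [UNIV]\<^bsup>2\<^esup> \<rightarrow> {..<j} \<and>
     baire_measurable_map off_diagonal (discrete_topology {..<j}) (\<lambda>(x, y). c {x, y})"

definition is_tree :: "bool list set \<Rightarrow> bool" where
  "is_tree T \<longleftrightarrow> (\<forall>t\<in>T. \<forall>s. prefix s t \<longrightarrow> s \<in> T)"

definition branches :: "bool list set \<Rightarrow> cantor set" where
  "branches T = {x. \<forall>n. map x [0..<n] \<in> T}"

definition tree_at :: "bool list set \<Rightarrow> bool list \<Rightarrow> bool list set" where
  "tree_at T t = {s \<in> T. prefix s t \<or> prefix t s}"

text \<open>Covering is needed only for sets of finite sequences.\<close>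

definition covers :: "bool list set \<Rightarrow> nat set \<Rightarrow> bool" where
  "covers X a \<longleftrightarrow> (\<forall>n\<in>a. \<forall>i. \<exists>s\<in>X. n < length s \<and> s ! n = i)"

text \<open>
  Splitting trees, as conditions of splitting forcing, are nonempty: the empty tree satisfies the
  covering clause vacuously and would be homogeneous for every coloring.
\<close>

definition splitting_tree :: "bool list set \<Rightarrow> bool" where
  "splitting_tree T \<longleftrightarrow>
     is_tree T \<and> T \<noteq> {} \<and> (\<forall>t\<in>T. \<exists>a. finite (UNIV - a) \<and> covers (tree_at T t) a)"

end

theory Submission
  imports Defs
begin

text \<open>
  Off a meager set every color class is open, so pairs of incompatible sequences can be extended to
  rectangles on which the color is generically constant. For some color \<open>k\<close> and some \<open>s0\<close>, every
  extension of \<open>s0\<close> splits into two extensions whose rectangle has generic color \<open>k\<close>: otherwise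
  one excludes the colors one after the other and ends below a sequence without such rectangles at
  all. A fusion now produces a tree below \<open>s0\<close> which only splits in this way and whose pairs of
  branches avoid the countably many nowhere dense sets. Only two leaves at a time have to be
  extended in a prescribed way, so among any three leaves one is free to take, at each new
  coordinate, the value opposite to another one; this makes the tree splitting.
\<close>

lemma prefix_eq_take: "prefix u v \<Longrightarrow> take (length u) v = u"
  by (auto simp: prefix_def)

lemma prefix_of_take_eq: "take l v = u \<Longrightarrow> prefix u v"
  using take_is_prefix by blast

section \<open>The topology of pairs of distinct points\<close>

definition cyl :: "bool list \<Rightarrow> cantor set" where
  "cyl u = {x. map x [0..<length u] = u}"

lemma in_cyl_iff: "x \<in> cyl u \<longleftrightarrow> (\<forall>i<length u. x i = u ! i)"
  unfolding cyl_def mem_Collect_eq list_eq_iff_nth_eq by simp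

lemma cyl_antimono: "prefix u v \<Longrightarrow> cyl v \<subseteq> cyl u"
  by (auto simp: in_cyl_iff prefix_def nth_append)

lemma in_cyl_restrict: "x \<in> cyl (map x [0..<m])"
  by (simp add: cyl_def)

lemma cyl_nonempty: "cyl u \<noteq> {}"
proof -
  have "(\<lambda>i. u ! i) \<in> cyl u" by (simp add: in_cyl_iff)
  then show ?thesis by blast
qed

lemma prefix_restrict:
  assumes "x \<in> cyl u" "length u \<le> m"
  shows "prefix u (map x [0..<m])"
proof -
  have "take (length u) (map x [0..<m]) = u"
    using assms by (simp add: cyl_def take_map)
  then show ?thesis by (metis take_is_prefix)
qed

lemma parallel_cyl_neq: "u \<parallel> v \<Longrightarrow> x \<in> cyl u \<Longrightarrow> y \<in> cyl v \<Longrightarrow> x \<noteq> y"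
proof
  assume "u \<parallel> v" "x \<in> cyl u" "y \<in> cyl v" "x = y"
  then have "prefix u (map x [0..<max (length u) (length v)])"
      "prefix v (map x [0..<max (length u) (length v)])"
    by (simp_all add: prefix_restrict)
  then have "prefix u v \<or> prefix v u" by (rule prefix_same_cases)
  with \<open>u \<parallel> v\<close> show False by blast
qed

lemma open_cyl: "open (cyl u)"
proof -
  have "open {x. \<forall>i\<in>{..<length u}. x (id i) \<in> {u ! i}}"
    by (rule product_topology_basis') (auto simp: open_discrete)
  moreover have "{x. \<forall>i\<in>{..<length u}. x (id i) \<in> {u ! i}} = cyl u"
    by (auto simp: in_cyl_iff)
  ultimately show ?thesis by simp
qed

lemma open_contains_cyl:
  assumes "open W" "x \<in> W"
  shows "\<exists>m. cyl (map x [0..<m]) \<subseteq> W"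
proof -
  have "openin (product_topology (\<lambda>i. euclidean) UNIV) W"
    using assms by (simp add: open_fun_def)
  from product_topology_open_contains_basis[OF this assms(2)]
  obtain X where X: "x \<in> Pi\<^sub>E UNIV X" "finite {i. X i \<noteq> UNIV}" "Pi\<^sub>E UNIV X \<subseteq> W" by auto
  obtain m where m: "\<And>i. X i \<noteq> UNIV \<Longrightarrow> i < m"
    using X(2) by (metis (mono_tags) finite_nat_set_iff_bounded mem_Collect_eq)
  have "y \<in> Pi\<^sub>E UNIV X" if "y \<in> cyl (map x [0..<m])" for y
  proof -
    have "y i \<in> X i" for i
    proof (cases "i < m")
      case True
      then have "y i = x i" using that by (simp add: in_cyl_iff)
      then show ?thesis using X(1) by auto
    next
      case False
      then show ?thesis using m by blast
    qed
    then show ?thesis by auto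
  qed
  then show ?thesis using X by blast
qed

text \<open>\<open>x\<close> and \<open>y\<close> are cut at lengths that reach both the given
  sequences and all coordinates constrained by a box inside \<open>W\<close>, which meets both
  demands at once.\<close>

lemma open_prod_contains_cyl:
  assumes W: "open W" "(x, y) \<in> W" and uv: "x \<in> cyl u" "y \<in> cyl v"
  shows "\<exists>u' v'. prefix u u' \<and> prefix v v' \<and> cyl u' \<times> cyl v' \<subseteq> W"
proof -
  obtain A B where AB: "open A" "open B" "(x, y) \<in> A \<times> B" "A \<times> B \<subseteq> W"
    using open_prod_elim[OF W] by blast
  obtain k l where kl: "cyl (map x [0..<k]) \<subseteq> A" "cyl (map y [0..<l]) \<subseteq> B"
    using open_contains_cyl AB by (metis mem_Sigma_iff)
  let ?u = "map x [0..<max k (length u)]" and ?v = "map y [0..<max l (length v)]"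
  have "prefix u ?u" "prefix v ?v" using uv by (auto intro: prefix_restrict)
  moreover have "prefix (map x [0..<k]) ?u" "prefix (map y [0..<l]) ?v"
    by (auto intro: prefix_restrict in_cyl_restrict)
  then have "cyl ?u \<times> cyl ?v \<subseteq> W"
    using cyl_antimono kl AB by (meson Sigma_mono subset_trans)
  ultimately show ?thesis by blast
qed

section \<open>Category in the space of pairs of distinct points\<close>

lemma open_off_diagonal: "open {(x::cantor, y). x \<noteq> y}"
proof -
  have "open {p :: cantor \<times> cantor. fst p i \<noteq> snd p i}" for i
    by (rule open_Collect_neq; rule continuous_on_product_then_coordinatewise)
      (rule continuous_on_fst continuous_on_snd, rule continuous_on_id)+
  then have "open (\<Union>i. {p :: cantor \<times> cantor. fst p i \<noteq> snd p i})" by blast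
  moreover have "(\<Union>i. {p :: cantor \<times> cantor. fst p i \<noteq> snd p i}) = {(x, y). x \<noteq> y}" by auto
  ultimately show ?thesis by simp
qed

lemma topspace_off_diagonal: "topspace off_diagonal = {(x, y). x \<noteq> y}"
  by (simp add: off_diagonal_def)

lemma openin_off_diagonal: "openin off_diagonal W \<longleftrightarrow> open W \<and> W \<subseteq> {(x, y). x \<noteq> y}"
  unfolding off_diagonal_def by (rule openin_open_eq[OF open_off_diagonal])

lemma openin_cyl_times:
  assumes "u \<parallel> v"
  shows "openin off_diagonal (cyl u \<times> cyl v)"
proof -
  have "cyl u \<times> cyl v \<subseteq> {(x, y). x \<noteq> y}" using parallel_cyl_neq[OF assms] by blast
  then show ?thesis by (simp add: openin_off_diagonal open_Times open_cyl)
qed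

text \<open>Makes the Baire category theorem applicable: the square of Cantor space is compact
  Hausdorff, and local compactness and regularity pass to the open complement of the
  diagonal.\<close>

lemma off_diagonal_locally_compact_regular:
  "locally_compact_space off_diagonal \<and> regular_space off_diagonal"
proof -
  let ?C = "product_topology (\<lambda>i::nat. euclidean :: bool topology) UNIV"
  have C: "(euclidean :: (cantor \<times> cantor) topology) = prod_topology ?C ?C"
    by (simp add: euclidean_product_topology)
  have "compact_space (euclidean :: bool topology)"
    by (simp add: compact_space_def finite_imp_compact)
  then have "compact_space (euclidean :: (cantor \<times> cantor) topology)"
    unfolding C by (simp add: compact_space_prod_topology compact_space_product_topology)
  moreover have "Hausdorff_space (euclidean :: bool topology)"
    unfolding Hausdorff_space_def
  proof (intro allI impI)
    fix x y :: bool assume "x \<in> topspace euclidean \<and> y \<in> topspace euclidean \<and> x \<noteq> y"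
    then show "\<exists>U V. openin euclidean U \<and> openin euclidean V \<and> x \<in> U \<and> y \<in> V \<and> disjnt U V"
      by (intro exI[of _ "{x}"] exI[of _ "{y}"]) (simp add: open_discrete)
  qed
  then have "Hausdorff_space (euclidean :: (cantor \<times> cantor) topology)"
    unfolding C by (simp add: Hausdorff_space_prod_topology Hausdorff_space_product_topology)
  ultimately have lc: "locally_compact_space (euclidean :: (cantor \<times> cantor) topology)"
      and reg: "regular_space (euclidean :: (cantor \<times> cantor) topology)"
    by (simp_all add: compact_imp_locally_compact_space compact_Hausdorff_imp_regular_space)
  have "openin euclidean {(x::cantor, y). x \<noteq> y}" using open_off_diagonal by (simp only: open_openin)
  then show ?thesis
    unfolding off_diagonal_def
    using locally_compact_space_open_subset[OF disjI2[OF reg] lc] regular_space_subtopology[OF reg]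
    by blast
qed

lemma cyl_times_not_subset:
  assumes "u \<parallel> v" "off_diagonal interior_of S = {}"
  shows "\<exists>x\<in>cyl u. \<exists>y\<in>cyl v. (x, y) \<notin> S"
proof (rule ccontr)
  assume "\<not> ?thesis"
  then have "cyl u \<times> cyl v \<subseteq> S" by blast
  then have "cyl u \<times> cyl v \<subseteq> off_diagonal interior_of S"
    using openin_cyl_times[OF assms(1)] by (rule interior_of_maximal)
  then show False using assms(2) cyl_nonempty by simp
qed

lemma nowhere_dense_inD:
  assumes "nowhere_dense_in X N"
  shows "N \<subseteq> X closure_of N" "X interior_of (X closure_of N) = {}"
proof -
  have "N \<subseteq> topspace X" using assms unfolding nowhere_dense_in_def by (rule conjunct1)
  then show "N \<subseteq> X closure_of N" by (rule closure_of_subset)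
  show "X interior_of (X closure_of N) = {}"
    using assms unfolding nowhere_dense_in_def by (rule conjunct2)
qed

text \<open>The closure of \<open>N\<close> has empty interior, so it leaves a nonempty open part of
  the rectangle, and this contains a smaller rectangle.\<close>

lemma nowhere_dense_avoid:
  assumes N: "nowhere_dense_in off_diagonal N" and "u \<parallel> v"
  shows "\<exists>u' v'. prefix u u' \<and> prefix v v' \<and> (cyl u' \<times> cyl v') \<inter> N = {}"
proof -
  let ?C = "off_diagonal closure_of N"
  note NC = nowhere_dense_inD(1)[OF N] and int = nowhere_dense_inD(2)[OF N]
  obtain x y where xy: "x \<in> cyl u" "y \<in> cyl v" "(x, y) \<notin> ?C"
    using cyl_times_not_subset[OF assms(2) int] by blast
  have "openin off_diagonal (cyl u \<times> cyl v - ?C)"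
    by (intro openin_diff openin_cyl_times assms closedin_closure_of)
  then have "open (cyl u \<times> cyl v - ?C)" by (simp add: openin_off_diagonal)
  from open_prod_contains_cyl[OF this _ xy(1,2)] xy
  obtain u' v' where "prefix u u'" "prefix v v'" "cyl u' \<times> cyl v' \<subseteq> cyl u \<times> cyl v - ?C"
    by blast
  then show ?thesis using NC by blast
qed

lemma cyl_times_residual:
  assumes "countable \<N>" "\<And>N. N \<in> \<N> \<Longrightarrow> nowhere_dense_in off_diagonal N" "u \<parallel> v"
  shows "\<exists>x\<in>cyl u. \<exists>y\<in>cyl v. (x, y) \<notin> \<Union>\<N>"
proof -
  \<comment> \<open>Closures turn the family into countably many closed sets without interior, as
    the Baire category theorem requires.\<close>
  let ?G = "(\<lambda>N. off_diagonal closure_of N) ` \<N>"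
  have "off_diagonal interior_of \<Union>?G = {}"
  proof (rule Baire_category_alt)
    show "completely_metrizable_space off_diagonal \<or>
        locally_compact_space off_diagonal \<and> regular_space off_diagonal"
      using off_diagonal_locally_compact_regular by (rule disjI2)
    show "countable ?G" using assms(1) by (rule countable_image)
    fix C assume "C \<in> ?G"
    then obtain M where M: "M \<in> \<N>" "C = off_diagonal closure_of M" by (rule imageE)
    show "closedin off_diagonal C \<and> off_diagonal interior_of C = {}"
      unfolding M(2) using nowhere_dense_inD(2)[OF assms(2)[OF M(1)]] by simp
  qed
  then obtain x y where xy: "x \<in> cyl u" "y \<in> cyl v" "(x, y) \<notin> \<Union>?G"
    using cyl_times_not_subset[OF assms(3)] by blast
  moreover have "N \<subseteq> off_diagonal closure_of N" if "N \<in> \<N>" for N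
    using assms(2)[OF that] by (rule nowhere_dense_inD)
  ultimately show ?thesis by blast
qed

section \<open>Fusion\<close>

text \<open>
  \<open>K u v\<close> will say that the rectangle of \<open>u\<close> and \<open>v\<close> has the chosen generic color, and \<open>D n u v\<close>
  that it misses the \<open>n\<close>-th nowhere dense set.
\<close>

locale fusion =
  fixes K :: "bool list \<Rightarrow> bool list \<Rightarrow> bool"
    and D :: "nat \<Rightarrow> bool list \<Rightarrow> bool list \<Rightarrow> bool"
    and s0 :: "bool list"
  assumes K_parallel: "K u v \<Longrightarrow> u \<parallel> v"
    and K_sym: "K u v \<Longrightarrow> K v u"
    and K_mono: "K u v \<Longrightarrow> prefix u u' \<Longrightarrow> prefix v v' \<Longrightarrow> K u' v'"
    and K_dense: "prefix s0 s \<Longrightarrow> \<exists>u v. prefix s u \<and> prefix s v \<and> K u v"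
    and D_mono: "D n u v \<Longrightarrow> prefix u u' \<Longrightarrow> prefix v v' \<Longrightarrow> D n u' v'"
    and D_dense: "u \<parallel> v \<Longrightarrow> \<exists>u' v'. prefix u u' \<and> prefix v v' \<and> D n u' v'"
begin

text \<open>The finite approximations of the tree. As \<open>K\<close> survives extension, it is
  settled for branches through different elements; only splits of a single element need
  care.\<close>

definition front :: "nat \<Rightarrow> bool list set \<Rightarrow> bool" where
  "front l F \<longleftrightarrow> finite F \<and> F \<noteq> {} \<and> (\<forall>f\<in>F. length f = l \<and> prefix s0 f) \<and> pairwise K F"

text \<open>Every element of \<open>F\<close> shares its restriction to \<open>L\<close> with at least three elements of \<open>F\<close>.\<close>

definition wide :: "nat \<Rightarrow> bool list set \<Rightarrow> bool" where
  "wide L F \<longleftrightarrow> (\<forall>f\<in>F. \<forall>a b. \<exists>r\<in>F. take L r = take L f \<and> r \<noteq> a \<and> r \<noteq> b)"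

text \<open>
  \<open>F'\<close> end-extends \<open>F\<close> from length \<open>l\<close> to \<open>l'\<close>, and above every restriction to \<open>L\<close> it takes both
  values at each new coordinate. The lag \<open>L \<le> l\<close> is needed because a node cannot be covered
  by its own extensions while it is being split.
\<close>

definition refines :: "nat \<Rightarrow> nat \<Rightarrow> bool list set \<Rightarrow> nat \<Rightarrow> bool list set \<Rightarrow> bool" where
  "refines L l F l' F' \<longleftrightarrow> l \<le> l' \<and> take l ` F' = F \<and>
     (\<forall>f\<in>F. \<forall>n i. l \<le> n \<longrightarrow> n < l' \<longrightarrow> (\<exists>s\<in>F'. take L s = take L f \<and> s ! n = i))"

section \<open>Calculus of refinements\<close>

lemma K_neq: "K u v \<Longrightarrow> u \<noteq> v"
  using K_parallel by blast

lemma refines_refl: "front l F \<Longrightarrow> refines L l F l F"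
  by (force simp: refines_def front_def image_iff)

lemma refines_lift:
  assumes "refines L l F l' F'" "f \<in> F"
  obtains f' where "f' \<in> F'" "take l f' = f"
  using assms by (auto simp: refines_def)

text \<open>A coordinate below \<open>l'\<close> takes its value in \<open>F'\<close>, and the
  witness lifts to \<open>F''\<close>; a later one is handled by \<open>F''\<close> above a lift of
  \<open>f\<close>. As \<open>L \<le> l\<close>, lifting keeps restrictions to
  \<open>L\<close>.\<close>

lemma refines_trans:
  assumes 1: "refines L l F l' F'" and 2: "refines L l' F' l'' F''" and L: "L \<le> l"
  shows "refines L l F l'' F''"
proof -
  have ll: "l \<le> l'" "l' \<le> l''" and im: "take l ` F' = F" "take l' ` F'' = F'"
    using 1 2 by (auto simp: refines_def)
  have "take l ` F'' = take l ` (take l' ` F'')"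
    using ll by (simp add: image_image min_def)
  then have "take l ` F'' = F" using im by simp
  moreover have "\<exists>s\<in>F''. take L s = take L f \<and> s ! n = i"
    if f: "f \<in> F" and n: "l \<le> n" "n < l''" for f n i
  proof (cases "n < l'")
    case True
    then obtain s where s: "s \<in> F'" "take L s = take L f" "s ! n = i"
      using 1 f n unfolding refines_def by blast
    obtain r where r: "r \<in> F''" "take l' r = s" using refines_lift[OF 2 s(1)] .
    have "take L r = take L s" using r L ll by (auto simp: min_def)
    moreover have "r ! n = s ! n" using r True by (metis nth_take)
    ultimately show ?thesis using r s by auto
  next
    case False
    obtain f' where f': "f' \<in> F'" "take l f' = f" using refines_lift[OF 1 f] .
    then obtain s where s: "s \<in> F''" "take L s = take L f'" "s ! n = i"
      using 2 False n unfolding refines_def by (metis not_less)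
    have "take L f' = take L f" using f' L by (auto simp: min_def)
    then show ?thesis using s by auto
  qed
  ultimately show ?thesis using ll unfolding refines_def by auto
qed

text \<open>It suffices to avoid the truncations of \<open>a\<close> and \<open>b\<close> in
  \<open>F\<close> and to lift.\<close>

lemma wide_refines:
  assumes "wide L F" "refines L l F l' F'" "L \<le> l"
  shows "wide L F'"
  unfolding wide_def
proof (intro ballI allI)
  fix f a b assume f: "f \<in> F'"
  then have "take l f \<in> F" using assms by (auto simp: refines_def)
  then obtain r where r: "r \<in> F" "take L r = take L (take l f)" "r \<noteq> take l a" "r \<noteq> take l b"
    using assms unfolding wide_def by blast
  obtain r' where r': "r' \<in> F'" "take l r' = r" using refines_lift[OF assms(2) r(1)] .
  have "take L r' = take L r" using r' assms by (auto simp: min_def)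
  also have "\<dots> = take L f" using r assms by (simp add: min_def)
  finally show "\<exists>r\<in>F'. take L r = take L f \<and> r \<noteq> a \<and> r \<noteq> b"
    using r r' by auto
qed

text \<open>
  Only \<open>a\<close> and \<open>b\<close> have prescribed extensions, so in each of the groups of at least three elements
  some other element is free to take the complementary values of one of its companions.
  The case \<open>a = b\<close> splits a node.
\<close>

lemma refine_pair:
  assumes F: "front l F" "wide L F" "L \<le> l"
    and ab: "a \<in> F" "b \<in> F" "prefix a u" "prefix b v" "length u = length v"
    and K: "a = b \<Longrightarrow> K u v"
  shows "\<exists>l' F'. front l' F' \<and> refines L l F l' F' \<and> u \<in> F' \<and> v \<in> F' \<and>
           (a \<noteq> b \<longrightarrow> inj_on (take l) F')"
proof -
  have len: "\<And>f. f \<in> F \<Longrightarrow> length f = l" using F by (auto simp: front_def)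
  define d where "d = length u - l"
  have lu: "length u = l + d" using ab len[of a] prefix_length_le[of a u] by (auto simp: d_def)
  \<comment> \<open>\<open>r\<close> picks one free element per group, as a function of the
    restriction to \<open>L\<close> alone, so that all members of a group share it.\<close>
  have "\<forall>f\<in>F. \<exists>r. r \<in> F \<and> take L r = take L f \<and> r \<noteq> a \<and> r \<noteq> b"
    using F unfolding wide_def by blast
  then have "\<forall>g\<in>take L ` F. \<exists>r. r \<in> F \<and> take L r = g \<and> r \<noteq> a \<and> r \<noteq> b" by auto
  then obtain r where r: "\<And>f. f \<in> F \<Longrightarrow> r (take L f) \<in> F \<and> take L (r (take L f)) = take L f \<and>
      r (take L f) \<noteq> a \<and> r (take L f) \<noteq> b"
    by (metis imageI)
  \<comment> \<open>\<open>q\<close> picks a companion of the free element; the two will take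
    opposite values at each new coordinate.\<close>
  have "\<forall>f\<in>F. \<exists>q. q \<in> F \<and> take L q = take L f \<and> q \<noteq> r (take L f)"
    using F unfolding wide_def by blast
  then have "\<forall>g\<in>take L ` F. \<exists>q. q \<in> F \<and> take L q = g \<and> q \<noteq> r g" by auto
  then obtain q where q: "\<And>f. f \<in> F \<Longrightarrow> q (take L f) \<in> F \<and> take L (q (take L f)) = take L f \<and>
      q (take L f) \<noteq> r (take L f)"
    by (metis imageI)
  \<comment> \<open>Prescribed extensions where there are any, padding by \<open>False\<close>
    elsewhere. If \<open>a = b\<close>, only \<open>u\<close> is assigned here.\<close>
  define h0 where "h0 f = (if f = a then u else if f = b then v else f @ replicate d False)" for f
  \<comment> \<open>The companion is not free, so \<open>h\<close> leaves it at \<open>h0\<close>;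
    \<open>a\<close> and \<open>b\<close> are never free, so their prescribed values
    survive.\<close>
  define h where "h f = (if f = r (take L f) then f @ map Not (drop l (h0 (q (take L f)))) else h0 f)" for f
  have h0: "length (h0 f) = l + d" "take l (h0 f) = f" if "f \<in> F" for f
    using len[OF that] ab lu prefix_eq_take[of a u] prefix_eq_take[of b v] len[of a] len[of b]
    by (auto simp: h0_def)
  have h: "length (h f) = l + d" "take l (h f) = f" if "f \<in> F" for f
    using h0[OF that] h0[of "q (take L f)"] q[OF that] len[OF that] by (auto simp: h_def)
  have ha: "h a = u" using r[OF ab(1)] by (auto simp: h_def h0_def)
  have hb: "a \<noteq> b \<Longrightarrow> h b = v" using r[OF ab(2)] by (auto simp: h_def h0_def)
  \<comment> \<open>For \<open>a \<noteq> b\<close> nothing is added, as \<open>v\<close> is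
    \<open>h b\<close>; for \<open>a = b\<close> this is the second half of the split.\<close>
  define F' where "F' = insert v (h ` F)"
  have tv: "take l v = b" using ab prefix_eq_take[of b v] len[of b] by auto
  have tk: "take l s \<in> F" "length s = l + d" if "s \<in> F'" for s
    using that h tv ab lu by (auto simp: F'_def)
  \<comment> \<open>Only the node \<open>a = b\<close> splits, so all other pairs inherit
    \<open>K\<close> from their restrictions in \<open>F\<close>.\<close>
  have same: "a = b \<and> {s, t} = {u, v}" if "s \<in> F'" "t \<in> F'" "s \<noteq> t" "take l s = take l t" for s t
  proof -
    have form: "w = v \<or> w = h (take l w)" if "w \<in> F'" for w
      using that h(2) by (auto simp: F'_def)
    show ?thesis
      using form[OF that(1)] form[OF that(2)] that(3,4) tv ha hb by (metis insert_commute)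
  qed
  have "K s t" if "s \<in> F'" "t \<in> F'" "s \<noteq> t" for s t
  proof (cases "take l s = take l t")
    case True
    then show ?thesis using same[OF that True] K K_sym that(3) by (metis doubleton_eq_iff)
  next
    case False
    then have "K (take l s) (take l t)"
      using F tk that by (auto simp: front_def pairwise_def)
    then show ?thesis by (rule K_mono) (auto simp: take_is_prefix)
  qed
  moreover have "prefix s0 s" if "s \<in> F'" for s
    using tk[OF that] F by (meson front_def prefix_order.trans take_is_prefix)
  ultimately have "front (l + d) F'"
    using F tk unfolding front_def pairwise_def F'_def by auto
  moreover have "refines L l F (l + d) F'"
    unfolding refines_def
  proof (intro conjI ballI allI impI)
    show "take l ` F' = F"
      using h(2) tv ab by (force simp: F'_def image_iff)
  next
    fix f n i assume f: "f \<in> F" and n: "l \<le> n" "n < l + d"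
    let ?q = "q (take L f)" and ?r = "r (take L f)"
    have qr: "?q \<in> F" "?r \<in> F" "take L ?q = take L f" "take L ?r = take L f" "?q \<noteq> ?r"
      using q[OF f] r[OF f] by auto
    have "h ?r = ?r @ map Not (drop l (h0 ?q))" "h ?q = h0 ?q"
      using qr by (auto simp: h_def)
    then have "h ?r ! n = (\<not> h ?q ! n)"
      using n len[OF qr(2)] h0[OF qr(1)] by (simp add: nth_append)
    moreover have "take L (h s) = take L s" if "s \<in> F" for s
      using h(2)[OF that] F(3) by (metis min_def take_take)
    ultimately show "\<exists>s\<in>F'. take L s = take L f \<and> s ! n = i"
      using qr unfolding F'_def by (metis image_eqI insertCI)
  qed simp
  moreover have "u \<in> F'" "v \<in> F'" using ha ab by (auto simp: F'_def)
  moreover have "inj_on (take l) F'" if "a \<noteq> b"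
    using same that by (meson inj_onI)
  ultimately show ?thesis by blast
qed

section \<open>Splitting and genericity steps\<close>

lemma obtain_same_length:
  fixes P :: "bool list \<Rightarrow> bool list \<Rightarrow> bool"
  assumes "P u v" and mono: "\<And>u v u' v'. P u v \<Longrightarrow> prefix u u' \<Longrightarrow> prefix v v' \<Longrightarrow> P u' v'"
  obtains u' v' where "prefix u u'" "prefix v v'" "length u' = length v'" "P u' v'"
proof
  let ?u = "u @ replicate (length v) False" and ?v = "v @ replicate (length u) False"
  show "prefix u ?u" "prefix v ?v" "length ?u = length ?v" by auto
  then show "P ?u ?v" using mono assms(1) by blast
qed

text \<open>The elements of \<open>F\<close> are split one at a time, \<open>B\<close> being those
  already treated. An extension different from any given \<open>a\<close> expresses that there are
  two.\<close>

lemma refine_split: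
  assumes F: "front l F" "wide L F" "L \<le> l"
  shows "\<exists>l' F'. front l' F' \<and> refines L l F l' F' \<and>
           (\<forall>f\<in>F. \<forall>a. \<exists>r\<in>F'. take l r = f \<and> r \<noteq> a)"
proof -
  have "finite F" using F by (simp add: front_def)
  moreover have "B \<subseteq> F \<longrightarrow> (\<exists>l' F'. front l' F' \<and> refines L l F l' F' \<and>
           (\<forall>f\<in>B. \<forall>a. \<exists>r\<in>F'. take l r = f \<and> r \<noteq> a))" if "finite B" for B
    using that
  proof (induction B)
    case empty
    show ?case using F(1) refines_refl[OF F(1), of L] by blast
  next
    case (insert f B)
    show ?case
    proof
      assume sub: "insert f B \<subseteq> F"
      then obtain l1 F1 where F1: "front l1 F1" "refines L l F l1 F1"
        and B: "\<And>f a. f \<in> B \<Longrightarrow> \<exists>r\<in>F1. take l r = f \<and> r \<noteq> a"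
        using insert by auto
      have l: "l \<le> l1" using F1 by (simp add: refines_def)
      \<comment> \<open>Earlier steps may have lengthened \<open>f\<close>, so the split takes place
        above some lift of it.\<close>
      obtain g where g: "g \<in> F1" "take l g = f"
        using refines_lift[OF F1(2)] sub by blast
      then have "prefix s0 g" using F1 by (simp add: front_def)
      then obtain u' v' where u': "prefix g u'" "prefix g v'" "K u' v'" using K_dense by blast
      obtain u v where uv: "prefix u' u" "prefix v' v" "length u = length v" "K u v"
        using obtain_same_length[of K, OF u'(3)] K_mono by metis
      have gu: "prefix g u" "prefix g v" using u' uv by auto
      obtain l2 F2 where F2: "front l2 F2" "refines L l1 F1 l2 F2" "u \<in> F2" "v \<in> F2"
        using refine_pair[OF F1(1) wide_refines[OF F(2) F1(2) F(3)] _ g(1) g(1) gu uv(3) uv(4)] F(3) l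
        by (metis order_trans)
      have "refines L l F l2 F2" using refines_trans[OF F1(2) F2(2) F(3)] .
      moreover have "\<exists>r\<in>F2. take l r = f' \<and> r \<noteq> a" if f': "f' \<in> insert f B" for f' a
      proof (cases "f' = f")
        case True
        have "take l w = f" if "prefix g w" for w
          using that g l F1 by (auto simp: prefix_def front_def)
        then show ?thesis using True F2 gu K_neq[OF uv(4)] by metis
      next
        case False
        then obtain r where r: "r \<in> F1" "take l r = f'" "r \<noteq> take l1 a" using B f' by blast
        obtain r' where r': "r' \<in> F2" "take l1 r' = r" using refines_lift[OF F2(2) r(1)] .
        then have "take l r' = f'" using r l by (auto simp: min_def)
        then show ?thesis using r r' by auto
      qed
      ultimately show "\<exists>l' F'. front l' F' \<and> refines L l F l' F' \<and>
           (\<forall>f\<in>insert f B. \<forall>a. \<exists>r\<in>F'. take l r = f \<and> r \<noteq> a)"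
        using F2 by blast
    qed
  qed
  ultimately show ?thesis by blast
qed

text \<open>The pairs from \<open>F\<close> are treated in turn. Only distinct nodes are extended,
  so nothing splits; injectivity of \<open>take l\<close> records this and identifies each new pair
  by its restrictions in \<open>F\<close>.\<close>

lemma refine_dense:
  assumes F: "front l F" "wide L F" "L \<le> l"
  shows "\<exists>l' F'. front l' F' \<and> refines L l F l' F' \<and> pairwise (D n) F'"
proof -
  have "finite (F \<times> F)" using F by (simp add: front_def)
  moreover have "\<exists>l' F'. front l' F' \<and> refines L l F l' F' \<and> inj_on (take l) F' \<and>
      (\<forall>s\<in>F'. \<forall>t\<in>F'. s \<noteq> t \<longrightarrow> (take l s, take l t) \<in> P \<longrightarrow> D n s t)" if "finite P" for P
    using that
  proof (induction P)
    case empty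
    have "take l f = f" if "f \<in> F" for f using F(1) that by (simp add: front_def)
    then have "inj_on (take l) F" by (simp add: inj_on_def)
    with F(1) refines_refl[OF F(1), of L] show ?case by (intro exI[of _ l] exI[of _ F]) simp
  next
    case (insert p P)
    then obtain l1 F1 where F1: "front l1 F1" "refines L l F l1 F1" "inj_on (take l) F1"
      and P: "\<And>s t. s \<in> F1 \<Longrightarrow> t \<in> F1 \<Longrightarrow> s \<noteq> t \<Longrightarrow> (take l s, take l t) \<in> P \<Longrightarrow> D n s t"
      by blast
    have l: "l \<le> l1" using F1 by (simp add: refines_def)
    show ?case
    proof (cases "\<exists>a\<in>F1. \<exists>b\<in>F1. a \<noteq> b \<and> p = (take l a, take l b)")
      \<comment> \<open>\<open>p\<close> does not come from two distinct elements, so there is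
        nothing to extend.\<close>
      case False
      then have "D n s t" if "s \<in> F1" "t \<in> F1" "s \<noteq> t" "(take l s, take l t) \<in> insert p P" for s t
        using P[of s t] that by blast
      then show ?thesis using F1 by blast
    next
      case True
      then obtain a b where ab: "a \<in> F1" "b \<in> F1" "a \<noteq> b" and p: "p = (take l a, take l b)" by blast
      have "a \<parallel> b" using F1 ab K_parallel by (auto simp: front_def pairwise_def)
      then obtain u' v' where u': "prefix a u'" "prefix b v'" "D n u' v'" using D_dense by blast
      obtain u v where uv: "prefix u' u" "prefix v' v" "length u = length v" "D n u v"
        using obtain_same_length[of "D n", OF u'(3)] D_mono by metis
      have gu: "prefix a u" "prefix b v" using u' uv by auto
      obtain l2 F2 where F2: "front l2 F2" "refines L l1 F1 l2 F2" "u \<in> F2" "v \<in> F2"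
          "inj_on (take l1) F2"
        using refine_pair[OF F1(1) wide_refines[OF F(2) F1(2) F(3)] _ ab(1,2) gu uv(3)] F(3) l ab(3)
        by (metis order_trans)
      have tt: "take l s = take l (take l1 s)" for s :: "bool list" using l by (simp add: min_def)
      have t1: "take l1 s \<in> F1" if "s \<in> F2" for s using F2 that by (auto simp: refines_def)
      have tu: "take l1 u = a" "take l1 v = b"
        using prefix_eq_take[OF gu(1)] prefix_eq_take[OF gu(2)] ab F1(1) by (simp_all add: front_def)
      have inj: "inj_on (take l) F2"
      proof (rule inj_onI)
        fix s t assume st: "s \<in> F2" "t \<in> F2" "take l s = take l t"
        then have "take l (take l1 s) = take l (take l1 t)" by (simp only: tt[symmetric])
        then have "take l1 s = take l1 t" using inj_onD[OF F1(3)] t1 st by blast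
        then show "s = t" using inj_onD[OF F2(5)] st by blast
      qed
      have "D n s t" if st: "s \<in> F2" "t \<in> F2" "s \<noteq> t" "(take l s, take l t) \<in> insert p P" for s t
      proof (cases "(take l s, take l t) = p")
        case True
        then have "take l s = take l a" "take l t = take l b" using p by simp_all
        moreover have "take l u = take l a" "take l v = take l b"
          using tt[of u] tt[of v] by (simp_all only: tu)
        ultimately have "take l s = take l u" "take l t = take l v" by simp_all
        then have "s = u" "t = v" using inj st F2 by (meson inj_onD)+
        then show ?thesis using uv by simp
      next
        case False
        then have "(take l (take l1 s), take l (take l1 t)) \<in> P"
          using st(4) by (simp only: tt[symmetric] insert_iff) simp
        moreover have "take l1 s \<noteq> take l1 t" using F2 st by (meson inj_onD)
        ultimately have "D n (take l1 s) (take l1 t)" using P t1 st by blast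
        then show ?thesis by (rule D_mono) (auto simp: take_is_prefix)
      qed
      then show ?thesis using F2 inj refines_trans[OF F1(2) F2(2) F(3)] by blast
    qed
  qed
  ultimately obtain l' F' where F': "front l' F'" "refines L l F l' F'" "inj_on (take l) F'"
      "\<forall>s\<in>F'. \<forall>t\<in>F'. s \<noteq> t \<longrightarrow> (take l s, take l t) \<in> F \<times> F \<longrightarrow> D n s t"
    by meson
  moreover have "take l s \<in> F" if "s \<in> F'" for s using F' that by (auto simp: refines_def)
  ultimately show ?thesis by (auto simp: pairwise_def)
qed

text \<open>Splitting twice gives enough extensions of each element for \<open>wide l\<close>. The
  genericity step comes last because splitting creates new pairs.\<close>

lemma refine_step:
  assumes F: "front l F" "wide L F" "L \<le> l"
  shows "\<exists>l' F'. front l' F' \<and> wide l F' \<and> l < l' \<and> refines L l F l' F' \<and> pairwise (D n) F'"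
proof -
  obtain l1 F1 where F1: "front l1 F1" "refines L l F l1 F1"
    and s1: "\<And>f a. f \<in> F \<Longrightarrow> \<exists>r\<in>F1. take l r = f \<and> r \<noteq> a"
    using refine_split[OF F] by blast
  have l: "l \<le> l1" using F1 by (simp add: refines_def)
  obtain l2 F2 where F2: "front l2 F2" "refines L l1 F1 l2 F2"
    and s2: "\<And>f a. f \<in> F1 \<Longrightarrow> \<exists>r\<in>F2. take l1 r = f \<and> r \<noteq> a"
    using refine_split[OF F1(1) wide_refines[OF F(2) F1(2) F(3)]] F(3) l by (metis order_trans)
  have r2: "refines L l F l2 F2" using refines_trans[OF F1(2) F2(2) F(3)] .
  have l2: "l1 \<le> l2" using F2 by (simp add: refines_def)
  obtain l3 F3 where F3: "front l3 F3" "refines L l2 F2 l3 F3" "pairwise (D n) F3"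
    using refine_dense[OF F2(1) wide_refines[OF F(2) r2 F(3)]] F(3) l l2 by (metis order_trans)
  have r3: "refines L l F l3 F3" using refines_trans[OF r2 F3(2) F(3)] .
  have tt: "take l s = take l (take l1 s)" "take l1 s = take l1 (take l2 s)" for s :: "bool list"
    using l l2 by (simp_all add: min_def)
  have w: "\<exists>r\<in>F3. take l r = f \<and> r \<noteq> a \<and> r \<noteq> b" if f: "f \<in> F" for f a b
  proof -
    \<comment> \<open>The first split serves to avoid \<open>a\<close>, the second to avoid
      \<open>b\<close>.\<close>
    obtain g where g: "g \<in> F1" "take l g = f" "g \<noteq> take l1 a" using s1 f by blast
    obtain g' where g': "g' \<in> F2" "take l1 g' = g" "g' \<noteq> take l2 b" using s2 g by blast
    obtain r where r: "r \<in> F3" "take l2 r = g'" using refines_lift[OF F3(2) g'(1)] .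
    show ?thesis using r g g' tt by metis
  qed
  have "wide l F3" unfolding wide_def
    using w r3 by (auto simp: refines_def)
  moreover have "l < l3"
  proof -
    obtain f where f: "f \<in> F" using F by (auto simp: front_def)
    obtain r where r: "r \<in> F3" "take l r = f" "r \<noteq> f" using w[OF f, of f f] by blast
    have "length r = l3" using F3 r by (auto simp: front_def)
    then show ?thesis using r by (metis not_less take_all)
  qed
  ultimately show ?thesis using F3 r3 by blast
qed

text \<open>Splitting \<open>s0\<close> and then one half gives three sequences with
  \<open>K\<close> between any two. They share the empty restriction and so form one group for lag
  \<open>0\<close>.\<close>

lemma initial_front: "\<exists>l F. front l F \<and> wide 0 F"
proof -
  obtain u v where uv: "prefix s0 u" "prefix s0 v" "K u v" using K_dense by blast
  obtain a b where ab: "prefix u a" "prefix u b" "K a b" using K_dense[OF uv(1)] by blast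
  define pad where "pad w = w @ replicate (length a + length b + length v - length w) False" for w
  have pad: "prefix w (pad w)" for w by (simp add: pad_def)
  have K: "K (pad a) (pad b)" "K (pad a) (pad v)" "K (pad b) (pad v)"
    using K_mono ab uv pad by (meson prefix_order.trans)+
  have s0: "prefix s0 (pad a)" "prefix s0 (pad b)" "prefix s0 (pad v)"
    using ab uv pad by (meson prefix_order.trans)+
  let ?F = "{pad a, pad b, pad v}"
  have "front (length a + length b + length v) ?F"
    using K s0 K_sym by (auto simp: front_def pairwise_def pad_def)
  moreover have "wide 0 ?F"
    using K_neq[OF K(1)] K_neq[OF K(2)] K_neq[OF K(3)] by (auto simp: wide_def)
  ultimately show ?thesis by blast
qed

text \<open>The tree is the downward closure of a sequence of fronts. Distinct branches pass through
  different elements of all late fronts and take \<open>K\<close> and \<open>D\<close> from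
  there.\<close>

theorem splitting_tree_exists:
  "\<exists>T. splitting_tree T \<and> (\<forall>x\<in>branches T. \<forall>y\<in>branches T. x \<noteq> y \<longrightarrow>
     (\<exists>m. K (map x [0..<m]) (map y [0..<m])) \<and>
     (\<forall>n. \<exists>m. D n (map x [0..<m]) (map y [0..<m])))"
proof -
  \<comment> \<open>Step \<open>n\<close> treats \<open>D (fst (prod_decode n))\<close>, so every \<open>D i\<close> recurs after any two branches have split.\<close>
  let ?P = "\<lambda>(n::nat) (L, l, F). front l F \<and> wide L F \<and> L \<le> l"
  let ?Q = "\<lambda>n (L, l, F) (L', l', F'). L' = l \<and> l < l' \<and> refines L l F l' F' \<and>
              pairwise (D (fst (prod_decode n))) F'"
  have "\<exists>f. \<forall>n. ?P n (f n) \<and> ?Q n (f n) (f (Suc n))"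
  proof (rule dependent_nat_choice)
    obtain l F where "front l F \<and> wide 0 F" using initial_front by blast
    then show "\<exists>x. ?P 0 x" by (intro exI[of _ "(0, l, F)"]) auto
  next
    fix x n assume x: "?P n x"
    obtain L l F where xx: "x = (L, l, F)" by (cases x)
    have "front l F" "wide L F" "L \<le> l" using x xx by auto
    from refine_step[OF this, of "fst (prod_decode n)"]
    obtain l' F' where *: "front l' F'" "wide l F'" "l < l'" "refines L l F l' F'"
        "pairwise (D (fst (prod_decode n))) F'" by blast
    show "\<exists>y. ?P (Suc n) y \<and> ?Q n x y"
      by (rule exI[of _ "(l, l', F')"]) (use * xx in auto)
  qed
  then obtain f where f0: "\<forall>n. ?P n (f n) \<and> ?Q n (f n) (f (Suc n))" ..
  have f: "?P n (f n)" "?Q n (f n) (f (Suc n))" for n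
    using f0[rule_format, of n] by (rule conjunct1, rule conjunct2)
  define L l F where "L n = fst (f n)" and "l n = fst (snd (f n))" and "F n = snd (snd (f n))" for n
  have fr: "front (l n) (F n)" for n
    using f(1)[of n] by (auto simp: L_def l_def F_def split: prod.splits)
  \<comment> \<open>Since the lag is one stage, refining \<open>F (Suc n)\<close> covers the new
    coordinates above each element of \<open>F n\<close>.\<close>
  have step: "L (Suc n) = l n" "l n < l (Suc n)" "refines (L n) (l n) (F n) (l (Suc n)) (F (Suc n))"
      "pairwise (D (fst (prod_decode n))) (F (Suc n))" for n
    using f(2)[of n] by (auto simp: L_def l_def F_def split: prod.splits)
  have len: "s \<in> F n \<Longrightarrow> length s = l n" for s n using fr[of n] by (auto simp: front_def)
  have lmono: "strict_mono l" using step(2) by (simp add: strict_mono_Suc_iff)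
  have l_le: "l n \<le> l m" if "n \<le> m" for n m using lmono that by (simp add: strict_mono_less_eq)
  have down: "take (l n) ` F (n + d) = F n" for n d
  proof (induction d)
    case 0
    show ?case using len[of _ n] by (auto simp: image_iff)
  next
    case (Suc d)
    have "take (l n) ` F (Suc (n + d)) = take (l n) ` (take (l (n + d)) ` F (Suc (n + d)))"
      using l_le[of n "n + d"] by (simp add: image_image min_def)
    also have "take (l (n + d)) ` F (Suc (n + d)) = F (n + d)"
      using step(3)[of "n + d"] by (auto simp: refines_def)
    finally show ?case using Suc by simp
  qed
  have lift: "\<exists>r\<in>F m. prefix s r" if "s \<in> F n" "n \<le> m" for s n m
  proof -
    have "s \<in> take (l n) ` F m" using down[of n "m - n"] that by simp
    then show ?thesis using take_is_prefix by blast
  qed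
  define T where "T = {t. \<exists>n. \<exists>s\<in>F n. prefix t s}"
  have "is_tree T" unfolding is_tree_def T_def by (auto intro: prefix_order.trans)
  moreover have "T \<noteq> {}" using fr[of 0] unfolding T_def front_def by blast
  moreover have "\<exists>a. finite (UNIV - a) \<and> covers (tree_at T t) a" if "t \<in> T" for t
  proof -
    from that obtain n s where s: "s \<in> F n" "prefix t s" unfolding T_def by blast
    have "\<exists>r\<in>tree_at T t. i < length r \<and> r ! i = e" if i: "l (Suc n) \<le> i" for i e
    proof -
      have ex: "i < l (Suc i)" using lmono by (meson Suc_le_lessD strict_mono_imp_increasing)
      \<comment> \<open>\<open>p\<close> is the first stage reaching coordinate \<open>i\<close>, so
        \<open>i\<close> is new in the step from \<open>Suc m\<close> to \<open>p\<close>, which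
        covers above level \<open>l m\<close>. The lag is why the bound is \<open>l (Suc n)\<close>
        and not \<open>l n\<close>: it gives \<open>n \<le> m\<close>.\<close>
      define p where "p = (LEAST p. i < l p)"
      have p: "i < l p" unfolding p_def by (rule LeastI[of "\<lambda>p. i < l p", OF ex])
      then have "Suc n < p" using i l_le[of p "Suc n"] by linarith
      then obtain m where m: "p = Suc (Suc m)" "n \<le> m"
        by (intro that[of "p - 2"]) auto
      have im: "l (Suc m) \<le> i"
        using not_less_Least[of "Suc m" "\<lambda>p. i < l p"] m(1) by (simp add: p_def)
      obtain g where g: "g \<in> F m" "prefix s g" using lift s m by blast
      obtain g' where g': "g' \<in> F (Suc m)" "take (l m) g' = g" using refines_lift[OF step(3) g(1)] .
      have "refines (l m) (l (Suc m)) (F (Suc m)) (l p) (F p)"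
        using step(3)[of "Suc m"] by (simp only: m step(1))
      then obtain r where r: "r \<in> F p" "take (l m) r = take (l m) g'" "r ! i = e"
        using g'(1) im p unfolding refines_def by blast
      have "prefix g r" using r g' prefix_of_take_eq by metis
      then have "prefix t r" using s g by (meson prefix_order.trans)
      moreover have "r \<in> T" using r by (auto simp: T_def)
      moreover have "i < length r" using len[OF r(1)] p by simp
      ultimately show ?thesis using r by (auto simp: tree_at_def)
    qed
    then have "covers (tree_at T t) {l (Suc n)..}" by (auto simp: covers_def)
    moreover have "finite (UNIV - {l (Suc n)..})"
      by (simp add: Compl_eq_Diff_UNIV[symmetric])
    ultimately show ?thesis by blast
  qed
  ultimately have "splitting_tree T" by (simp add: splitting_tree_def)
  \<comment> \<open>The restriction lies below an element of a front at some unknown stage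
    \<open>m\<close>; this is lifted to stage \<open>max n m\<close> and cut back to length
    \<open>l n\<close>.\<close>
  moreover have branch: "map x [0..<l n] \<in> F n" if x: "x \<in> branches T" for x n
  proof -
    have "map x [0..<l n] \<in> T" using x by (auto simp: branches_def)
    then obtain m s where s: "s \<in> F m" "prefix (map x [0..<l n]) s" unfolding T_def by blast
    obtain r where r: "r \<in> F (max n m)" "prefix s r" using lift[OF s(1), of "max n m"] by auto
    have "prefix (map x [0..<l n]) r" using s r by (meson prefix_order.trans)
    then have "take (l n) r = map x [0..<l n]" using prefix_eq_take by fastforce
    moreover have "take (l n) r \<in> F n" using down[of n "max n m - n"] r by auto
    ultimately show ?thesis by simp
  qed
  moreover have "(\<exists>m. K (map x [0..<m]) (map y [0..<m])) \<and>
     (\<forall>n. \<exists>m. D n (map x [0..<m]) (map y [0..<m]))"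
    if xy: "x \<in> branches T" "y \<in> branches T" "x \<noteq> y" for x y
  proof -
    obtain i where i: "x i \<noteq> y i" using xy by auto
    have ne: "map x [0..<l m] \<noteq> map y [0..<l m]" if "i < m" for m
    proof -
      have "i < l m" using that lmono by (meson le_trans linorder_not_le strict_mono_imp_increasing)
      then show ?thesis using i by (auto dest!: arg_cong[where f = "\<lambda>s. s ! i"])
    qed
    have "K (map x [0..<l (Suc i)]) (map y [0..<l (Suc i)])"
      using fr[of "Suc i"] branch xy ne[of "Suc i"] by (auto simp: front_def pairwise_def)
    moreover have "\<exists>m. D n (map x [0..<m]) (map y [0..<m])" for n
    proof -
      let ?m = "prod_encode (n, i)"
      have "D n (map x [0..<l (Suc ?m)]) (map y [0..<l (Suc ?m)])"
        using step(4)[of ?m] branch xy ne[of "Suc ?m"] le_prod_encode_2[of i n]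
        by (auto simp: pairwise_def)
      then show ?thesis by blast
    qed
    ultimately show ?thesis by blast
  qed
  ultimately show ?thesis by blast
qed

end

section \<open>Homogeneity\<close>

theorem theorem3p3:
  fixes j :: nat and c :: "cantor set \<Rightarrow> nat"
  assumes "baire_coloring j c"
  shows "\<exists>T. splitting_tree T \<and> c constant_on [branches T]\<^bsup>2\<^esup>"
proof -

  \<comment> \<open>Generic color classes\<close>
  let ?A = "\<lambda>k. {p \<in> topspace off_diagonal. (\<lambda>(x, y). c {x, y}) p \<in> {k}}"
  have col: "c {x, y} < j" if "x \<noteq> y" for x y
    using assms that unfolding baire_coloring_def by (auto simp: doubleton_in_nsets_2)
  \<comment> \<open>One relation for the open set and the nowhere dense sets lets both be chosen for
    all colors at once.\<close>
  define R where "R k U N \<longleftrightarrow> openin off_diagonal U \<and> (\<forall>n::nat. nowhere_dense_in off_diagonal (N n)) \<and>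
      (?A k - U) \<union> (U - ?A k) = (\<Union>n. N n)" for k U N
  have "\<exists>U N. R k U N" if "k < j" for k
  proof -
    have "openin (discrete_topology {..<j}) {k}" using that by simp
    then have "baire_property_in off_diagonal (?A k)"
      using assms unfolding baire_coloring_def baire_measurable_map_def by blast
    then obtain U where U: "openin off_diagonal U" "meager_in off_diagonal ((?A k - U) \<union> (U - ?A k))"
      unfolding baire_property_in_def by (elim conjE exE)
    from U(2) obtain N :: "nat \<Rightarrow> (cantor \<times> cantor) set"
      where "\<forall>n. nowhere_dense_in off_diagonal (N n)" "(?A k - U) \<union> (U - ?A k) = (\<Union>n. N n)"
      unfolding meager_in_def by (elim conjE exE)
    with U(1) have "R k U N" unfolding R_def by (intro conjI)
    then show ?thesis by blast
  qed
  then obtain U N where UN: "\<And>k. k < j \<Longrightarrow> R k (U k) (N k)" by metis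
  have U: "openin off_diagonal (U k)" if "k < j" for k
    using UN[OF that] unfolding R_def by (elim conjE)
  have N: "nowhere_dense_in off_diagonal (N k n)" if "k < j" for k n
    using UN[OF that] unfolding R_def by (elim conjE allE)
  have agree: "(x, y) \<in> U k \<longleftrightarrow> c {x, y} = k"
    if "k < j" "x \<noteq> y" "\<And>n. (x, y) \<notin> N k n" for k x y
  proof -
    have "(?A k - U k) \<union> (U k - ?A k) = (\<Union>n. N k n)"
      using UN[OF that(1)] unfolding R_def by (elim conjE)
    then have "(x, y) \<notin> (?A k - U k) \<union> (U k - ?A k)" using that(3) by simp
    moreover have "(x, y) \<in> topspace off_diagonal" using that(2) by (simp add: topspace_off_diagonal)
    ultimately show ?thesis by auto
  qed
  \<comment> \<open>\<open>U k\<close> need not be symmetric although the coloring is; admitting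
    either order makes \<open>K k\<close> symmetric.\<close>
  define K where "K k u v \<longleftrightarrow> cyl u \<times> cyl v \<subseteq> U k \<or> cyl v \<times> cyl u \<subseteq> U k" for k u v
  \<comment> \<open>\<open>i\<close> codes a color and an index, which puts all nowhere dense sets
    into one sequence. Codes with \<open>k \<ge> j\<close> hold trivially, as \<open>N k\<close> is
    controlled only for colors.\<close>
  define D where "D i u v \<longleftrightarrow> (case prod_decode i of (k, n) \<Rightarrow> k < j \<longrightarrow>
      (cyl u \<times> cyl v) \<inter> N k n = {} \<and> (cyl v \<times> cyl u) \<inter> N k n = {})" for i u v
  \<comment> \<open>A point of the rectangle outside all nowhere dense sets lies in
    \<open>U k\<close> for its own color \<open>k\<close>, and \<open>U k\<close> is open.\<close>
  have dec: "\<exists>k<j. \<exists>u' v'. prefix u u' \<and> prefix v v' \<and> K k u' v'" if uv: "u \<parallel> v" for u v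
  proof -
    let ?N = "(\<lambda>(k, n). N k n) ` ({..<j} \<times> UNIV)"
    have "countable ?N" by simp
    moreover have "nowhere_dense_in off_diagonal M" if "M \<in> ?N" for M using that N by auto
    ultimately obtain x y where xy: "x \<in> cyl u" "y \<in> cyl v" "(x, y) \<notin> \<Union>?N"
      using cyl_times_residual[of ?N u v, OF _ _ uv] by meson
    have ne: "x \<noteq> y" using parallel_cyl_neq[OF uv xy(1,2)] .
    define k where "k = c {x, y}"
    have k: "k < j" using col ne by (simp add: k_def)
    have "(x, y) \<notin> N k n" for n using xy(3) k by auto
    then have "(x, y) \<in> U k" using agree[OF k ne] k_def by simp
    moreover have "open (U k)" using U[OF k] by (simp add: openin_off_diagonal)
    ultimately obtain u' v' where "prefix u u'" "prefix v v'" "cyl u' \<times> cyl v' \<subseteq> U k"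
      using open_prod_contains_cyl[of "U k" x y u v] xy by blast
    then show ?thesis using k unfolding K_def by blast
  qed

  \<comment> \<open>A color that is dense below some sequence\<close>
  have "\<exists>k<j. \<exists>s0. \<forall>s. prefix s0 s \<longrightarrow> (\<exists>u v. prefix s u \<and> prefix s v \<and> K k u v)"
  proof (rule ccontr)
    assume contra: "\<not> ?thesis"
    have bad: "\<exists>s'. prefix s s' \<and> (\<forall>u v. prefix s' u \<longrightarrow> prefix s' v \<longrightarrow> \<not> K k u v)"
      if "k < j" for k s
      using contra that by blast
    \<comment> \<open>Excluding a color persists under extension, so \<open>bad\<close> can be
      iterated through all colors.\<close>
    have "m \<le> j \<longrightarrow> (\<exists>s. \<forall>k<m. \<forall>u v. prefix s u \<longrightarrow> prefix s v \<longrightarrow> \<not> K k u v)" for m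
    proof (induction m)
      case (Suc m)
      show ?case
      proof
        assume m: "Suc m \<le> j"
        then obtain s where s: "\<And>k u v. k < m \<Longrightarrow> prefix s u \<Longrightarrow> prefix s v \<Longrightarrow> \<not> K k u v"
          using Suc by auto
        obtain s' where "prefix s s'" "\<And>u v. prefix s' u \<Longrightarrow> prefix s' v \<Longrightarrow> \<not> K m u v"
          using bad[of m s] m by auto
        then show "\<exists>s. \<forall>k<Suc m. \<forall>u v. prefix s u \<longrightarrow> prefix s v \<longrightarrow> \<not> K k u v"
          using s by (metis less_Suc_eq prefix_order.trans)
      qed
    qed simp
    then obtain s where s: "\<And>k u v. k < j \<Longrightarrow> prefix s u \<Longrightarrow> prefix s v \<Longrightarrow> \<not> K k u v" by blast
    \<comment> \<open>With every color excluded below \<open>s\<close>, its two immediate extensions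
      contradict \<open>dec\<close>.\<close>
    have "s @ [False] \<parallel> s @ [True]" by (simp add: parallel_def)
    then obtain k u v where "k < j" "prefix (s @ [False]) u" "prefix (s @ [True]) v" "K k u v"
      using dec by blast
    then show False using s[of k u v] by (auto dest: append_prefixD)
  qed
  then obtain k s0 where k: "k < j"
    and s0: "\<And>s. prefix s0 s \<Longrightarrow> \<exists>u v. prefix s u \<and> prefix s v \<and> K k u v" by blast
  have Uk: "U k \<subseteq> {(x, y). x \<noteq> y}" using U[OF k] by (simp add: openin_off_diagonal)

  \<comment> \<open>Application of the fusion\<close>
  interpret fusion "K k" D s0
  proof
    fix u v assume K: "K k u v"
    show "K k v u" using K by (auto simp: K_def)
    \<comment> \<open>The cylinders of comparable sequences share a point \<open>x\<close>, and
      \<open>(x, x)\<close> would lie in \<open>U k\<close>.\<close>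
    show "u \<parallel> v"
    proof (rule ccontr)
      assume "\<not> u \<parallel> v"
      then have "cyl v \<subseteq> cyl u \<or> cyl u \<subseteq> cyl v" using cyl_antimono[of u v] cyl_antimono[of v u] by auto
      then obtain x where "x \<in> cyl u" "x \<in> cyl v" using cyl_nonempty[of u] cyl_nonempty[of v] by blast
      then have "(x, x) \<in> U k" using K unfolding K_def by blast
      then show False using Uk by blast
    qed
    show "K k u' v'" if "prefix u u'" "prefix v v'" for u' v'
      using K cyl_antimono[OF that(1)] cyl_antimono[OF that(2)] unfolding K_def by blast
  next
    fix s assume "prefix s0 s"
    then show "\<exists>u v. prefix s u \<and> prefix s v \<and> K k u v" by (rule s0)
  next
    fix i u v u' v' assume D: "D i u v" and p: "prefix u u'" "prefix v v'"
    obtain k n where i: "prod_decode i = (k, n)" by (rule prod.exhaust)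
    show "D i u' v'"
      using D cyl_antimono[OF p(1)] cyl_antimono[OF p(2)] unfolding D_def i prod.case by blast
  next
    fix i and u v :: "bool list" assume uv: "u \<parallel> v"
    obtain k n where i: "prod_decode i = (k, n)" by (rule prod.exhaust)
    show "\<exists>u' v'. prefix u u' \<and> prefix v v' \<and> D i u' v'"
    proof (cases "k < j")
      case True
      \<comment> \<open>Each order of the pair takes its own extension; the second keeps what the
        first achieved.\<close>
      obtain u1 v1 where 1: "prefix u u1" "prefix v v1" "cyl u1 \<times> cyl v1 \<inter> N k n = {}"
        using nowhere_dense_avoid[OF N[OF True] uv] by blast
      have "v1 \<parallel> u1" using uv 1(1,2) by (metis parallel_append parallel_commute prefix_def)
      then obtain u2 v2 where 2: "prefix u1 u2" "prefix v1 v2" "cyl v2 \<times> cyl u2 \<inter> N k n = {}"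
        using nowhere_dense_avoid[OF N[OF True]] by blast
      have "cyl u2 \<times> cyl v2 \<subseteq> cyl u1 \<times> cyl v1"
        using cyl_antimono[OF 2(1)] cyl_antimono[OF 2(2)] by blast
      then have "D i u2 v2" using 1(3) 2(3) unfolding D_def i prod.case by blast
      then show ?thesis using 1 2 by (meson prefix_order.trans)
    qed (auto simp: D_def i)
  qed
  obtain T where T: "splitting_tree T"
    and KT: "\<And>x y. x \<in> branches T \<Longrightarrow> y \<in> branches T \<Longrightarrow> x \<noteq> y \<Longrightarrow>
      \<exists>m. K k (map x [0..<m]) (map y [0..<m])"
    and DT: "\<And>x y i. x \<in> branches T \<Longrightarrow> y \<in> branches T \<Longrightarrow> x \<noteq> y \<Longrightarrow>
      \<exists>m. D i (map x [0..<m]) (map y [0..<m])"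
    using splitting_tree_exists by blast
  have "c {x, y} = k" if xy: "x \<in> branches T" "y \<in> branches T" "x \<noteq> y" for x y
  proof -
    have "(x, y) \<notin> N k n \<and> (y, x) \<notin> N k n" for n
    proof -
      obtain m where "D (prod_encode (k, n)) (map x [0..<m]) (map y [0..<m])" using DT xy by blast
      then show ?thesis using k in_cyl_restrict[of x m] in_cyl_restrict[of y m]
        unfolding D_def prod_encode_inverse prod.case by blast
    qed
    \<comment> \<open>Either order will do: both avoid every \<open>N k n\<close>, and the color
      depends only on the unordered pair.\<close>
    moreover have "(x, y) \<in> U k \<or> (y, x) \<in> U k"
      using KT[OF xy] in_cyl_restrict[of x] in_cyl_restrict[of y] unfolding K_def by blast
    moreover have "{y, x} = {x, y}" by (rule insert_commute)
    ultimately show ?thesis using agree[OF k, of x y] agree[OF k, of y x] xy(3) by auto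
  qed
  then have "c constant_on [branches T]\<^bsup>2\<^esup>"
    unfolding constant_on_def by (metis nsets2_E)
  with T show ?thesis by blast
qed

end
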